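(* Let $n,K\ge 1$, and let $\psi_{\mathrm{C}}:\mathbb{C}^n\to\mathbb{R}_{\ge 0}^{4n}$ and $\psi_{\mathrm{P}}^{(K)}:\mathbb{C}^n\to\mathbb{R}_{\ge 0}^{n\times K}$ be the Cartesian sign-split embedding and the polar phase-partition embedding (for a partition of $(-\pi,\pi]$ into $K$ disjoint sectors $\Theta_1,\dots,\Theta_K$). For each $\psi\in\{\psi_{\mathrm{C}},\psi_{\mathrm{P}}^{(K)}\}$, the Tanimoto distance $d_{\mathrm{Tan}}$ is a metric on the image $\psi(\mathbb{C}^n)$, and hence $$d_\psi(Z,W):=d_{\mathrm{Tan}}\bigl(\psi(Z),\psi(W)\bigr)$$ is a pseudometric on $\mathbb{C}^n$. The associated Tanimoto kernel $$K_\psi(Z,W):=J_{\mathrm{Tan}}\bigl(\psi(Z),\psi(W)\bigr)$$ is positive semidefinite on $\mathbb{C}^n$.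
   Context: Let $Z=(z_1,\dots,z_n)\in\mathbb{C}^n$ with $z_i=a_i+\mathrm{i}b_i=r_i\mathrm{e}^{\mathrm{i}\phi_i}$, where $a_i,b_i\in\mathbb{R}$, $r_i=|z_i|\ge 0$, and $\phi_i\in(-\pi,\pi]$ is the principal argument. For real $x$ write $x^+=\max\{x,0\}$, $x^-=\max\{-x,0\}$. Cartesian sign-split embedding: $\psi_{\mathrm{C}}(Z)=(a_1^+,a_1^-,b_1^+,b_1^-,\dots,a_n^+,a_n^-,b_n^+,b_n^-)\in\mathbb{R}_{\ge 0}^{4n}$. Polar phase-partition embedding: for a partition of $(-\pi,\pi]$ into $K$ disjoint sectors $\Theta_1,\dots,\Theta_K$ (e.g. left-open/right-closed intervals), $[\psi_{\mathrm{P}}^{(K)}(Z)]_{i,k}=r_i\,\mathbf{1}\{\phi_i\in\Theta_k\}$ for $i=1,\dots,n$, $k=1,\dots,K$; when $z_i=0$ the whole $i$-th row is zero. The space $\mathbb{R}_{\ge 0}^{n\times K}$ is identified with $\mathbb{R}_{\ge 0}^{nK}$. Tanimoto similarity and distance: for $U,V\in\mathbb{R}_{\ge 0}^{d}$, $J_{\mathrm{Tan}}(U,V)=\dfrac{\sum_j\min\{U_j,V_j\}}{\sum_j\max\{U_j,V_j\}}$ if $\sum_j\max\{U_j,V_j\}>0$, and $J_{\mathrm{Tan}}(U,V)=1$ if $U=V=0$; $d_{\mathrm{Tan}}(U,V)=1-J_{\mathrm{Tan}}(U,V)$. A kernel $k:\mathcal{X}\times\mathcal{X}\to\mathbb{R}$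 is positive semidefinite if it is symmetric and $\sum_{i,j}c_ic_jk(x_i,x_j)\ge 0$ for all finite families $x_i\in\mathcal{X}$, $c_i\in\mathbb{R}$. *)

theory Defs
  imports "HOL-Analysis.Analysis"
begin

text \<open>
  Vectors in \<open>\<complex>\<^sup>n\<close> are elements of \<^typ>\<open>complex ^ 'n\<close>, so that \<open>n = CARD('n) \<ge> 1\<close>. The spaces
  of real vectors of dimension \<open>4n\<close> and \<open>nK\<close> are indexed by pairs, the first component being the
  coordinate \<open>i\<close> of the complex vector.
\<close>

text \<open>
  The four entries of block \<open>i\<close> are listed in the order \<open>a\<^sup>+, a\<^sup>-, b\<^sup>+, b\<^sup>-\<close>, at the indices
  \<open>(i, 1), \<dots>, (i, 4)\<close> (where \<open>4 = 0\<close> in the numeral type \<^typ>\<open>4\<close>).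
\<close>

definition psi_C :: "complex ^ 'n \<Rightarrow> real ^ ('n::finite \<times> 4)" where
  "psi_C Z = (\<chi> p. (vector [max (Re (Z $ fst p)) 0, max (- Re (Z $ fst p)) 0,
                             max (Im (Z $ fst p)) 0, max (- Im (Z $ fst p)) 0] :: real ^ 4) $ snd p)"

text \<open>
  The sectors are an arbitrary indexed family of pairwise disjoint sets covering \<open>(-\<pi>, \<pi>]\<close>;
  they need not be intervals, and empty sectors are not excluded.
\<close>

definition phase_partition :: "('k \<Rightarrow> real set) \<Rightarrow> bool" where
  "phase_partition \<Theta> \<longleftrightarrow> disjoint_family \<Theta> \<and> (\<Union>k. \<Theta> k) = {-pi<..pi}"

text \<open>
  \<^const>\<open>Arg\<close> is the principal argument in \<open>(-\<pi>, \<pi>]\<close>. Its value at 0 does not matter, because the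
  modulus makes the whole row vanish there.
\<close>

definition psi_P :: "('k \<Rightarrow> real set) \<Rightarrow> complex ^ 'n \<Rightarrow> real ^ ('n::finite \<times> 'k::finite)" where
  "psi_P \<Theta> Z = (\<chi> p. cmod (Z $ fst p) * indicator (\<Theta> (snd p)) (Arg (Z $ fst p)))"

lemma psi_C_components:
  "psi_C Z $ (i, 1) = max (Re (Z $ i)) 0"
  "psi_C Z $ (i, 2) = max (- Re (Z $ i)) 0"
  "psi_C Z $ (i, 3) = max (Im (Z $ i)) 0"
  "psi_C Z $ (i, 4) = max (- Im (Z $ i)) 0"
  by (simp_all add: psi_C_def vector_def)

lemma psi_C_nonneg: "0 \<le> psi_C Z $ p"
proof (cases p)
  case (Pair i k)
  then show ?thesis
    using exhaust_4[of k] psi_C_components[of Z i] by auto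
qed

lemma psi_P_nonneg: "0 \<le> psi_P \<Theta> Z $ p"
  by (simp add: psi_P_def)

text \<open>
  For vectors with nonnegative entries, the case in which the sum of the maxima is not positive
  is exactly \<open>U = V = 0\<close>. On other vectors the value is immaterial.
\<close>

definition J_Tan :: "real ^ 'd \<Rightarrow> real ^ 'd \<Rightarrow> real" where
  "J_Tan U V =
     (if (\<Sum>j\<in>UNIV. max (U $ j) (V $ j)) > 0
      then (\<Sum>j\<in>UNIV. min (U $ j) (V $ j)) / (\<Sum>j\<in>UNIV. max (U $ j) (V $ j))
      else 1)"

definition d_Tan :: "real ^ 'd \<Rightarrow> real ^ 'd \<Rightarrow> real" where
  "d_Tan U V = 1 - J_Tan U V"

lemma J_Tan_else_case:
  assumes "\<And>j. 0 \<le> U $ j" and "\<And>j. 0 \<le> V $ j"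
  shows "\<not> (\<Sum>j\<in>UNIV. max (U $ j) (V $ j)) > 0 \<longleftrightarrow> U = 0 \<and> V = (0 :: real ^ 'd)"
proof -
  have nn: "\<And>j. 0 \<le> max (U $ j) (V $ j)"
    using assms by (simp add: le_max_iff_disj)
  have z: "max (U $ j) (V $ j) = 0 \<longleftrightarrow> U $ j = 0 \<and> V $ j = 0" for j
    using assms[of j] by (auto simp: max_def)
  have "\<not> (\<Sum>j\<in>UNIV. max (U $ j) (V $ j)) > 0 \<longleftrightarrow> (\<Sum>j\<in>UNIV. max (U $ j) (V $ j)) = 0"
    using sum_nonneg[of UNIV "\<lambda>j. max (U $ j) (V $ j)"] nn by force
  also have "\<dots> \<longleftrightarrow> (\<forall>j. max (U $ j) (V $ j) = 0)"
    using nn by (simp add: sum_nonneg_eq_0_iff)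
  also have "\<dots> \<longleftrightarrow> U = 0 \<and> V = 0"
    by (auto simp: z vec_eq_iff)
  finally show ?thesis .
qed

definition d_emb :: "('a \<Rightarrow> real ^ 'd) \<Rightarrow> 'a \<Rightarrow> 'a \<Rightarrow> real" where
  "d_emb \<psi> Z W = d_Tan (\<psi> Z) (\<psi> W)"

definition K_emb :: "('a \<Rightarrow> real ^ 'd) \<Rightarrow> 'a \<Rightarrow> 'a \<Rightarrow> real" where
  "K_emb \<psi> Z W = J_Tan (\<psi> Z) (\<psi> W)"

definition pseudometric_on :: "'a set \<Rightarrow> ('a \<Rightarrow> 'a \<Rightarrow> real) \<Rightarrow> bool" where
  "pseudometric_on X d \<longleftrightarrow>
     (\<forall>x\<in>X. \<forall>y\<in>X. 0 \<le> d x y) \<and>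
     (\<forall>x\<in>X. d x x = 0) \<and>
     (\<forall>x\<in>X. \<forall>y\<in>X. d x y = d y x) \<and>
     (\<forall>x\<in>X. \<forall>y\<in>X. \<forall>z\<in>X. d x z \<le> d x y + d y z)"

definition psd_kernel_on :: "'a set \<Rightarrow> ('a \<Rightarrow> 'a \<Rightarrow> real) \<Rightarrow> bool" where
  "psd_kernel_on X k \<longleftrightarrow>
     (\<forall>x\<in>X. \<forall>y\<in>X. k x y = k y x) \<and>
     (\<forall>(m::nat) x c. (\<forall>i<m. x i \<in> X) \<longrightarrow> 0 \<le> (\<Sum>i<m. \<Sum>j<m. c i * c j * k (x i) (x j)))"

end

theory Submission
  imports Defs
begin

text \<open>
  On nonnegative vectors write \<open>a\<close>, \<open>b\<close> for the coordinate sums of \<open>U\<close>, \<open>V\<close>, \<open>\<delta>\<close> for their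
  \<open>\<ell>\<^sup>1\<close> distance and \<open>m\<close> for the sum of minima. The Tanimoto distance is the Steinhaus transform
  \<open>2 \<delta> / (a + b + \<delta>)\<close> of \<open>\<delta>\<close> with base point \<open>0\<close>, which gives the triangle inequality.

  For positive semidefiniteness, \<open>2 (a + b) = (a + 1) (b + 1) - (a - 1) (b - 1)\<close> gives
  \<open>m / (a + b - m) = h / (1 - L)\<close> with \<open>h = 2 m / ((a + 1) (b + 1))\<close> and
  \<open>L = ((a - 1) / (a + 1)) ((b - 1) / (b + 1)) + h\<close>. Both \<open>h\<close> and \<open>L\<close> are positive semidefinite,
  and expanding the geometric series exhibits the kernel as a limit of sums of products of such
  kernels. On finitely many points all kernels involved are finite sums of kernels \<open>f x * f y\<close>, so
  that products need no Schur product theorem.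
\<close>

section \<open>Steinhaus transform\<close>

definition coord_sum :: "real ^ 'd \<Rightarrow> real" where
  "coord_sum U = (\<Sum>j\<in>UNIV. U $ j)"

definition l1_dist :: "real ^ 'd \<Rightarrow> real ^ 'd \<Rightarrow> real" where
  "l1_dist U V = (\<Sum>j\<in>UNIV. \<bar>U $ j - V $ j\<bar>)"

definition min_sum :: "real ^ 'd \<Rightarrow> real ^ 'd \<Rightarrow> real" where
  "min_sum U V = (\<Sum>j\<in>UNIV. min (U $ j) (V $ j))"

lemma sum_max_eq: "(\<Sum>j\<in>UNIV. max (U $ j) (V $ j)) = coord_sum U + coord_sum V - min_sum U V"
  unfolding coord_sum_def min_sum_def sum.distrib[symmetric] sum_subtractf[symmetric]
  by (rule sum.cong) auto

lemma l1_dist_eq: "l1_dist U V = coord_sum U + coord_sum V - 2 * min_sum U V"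
  unfolding coord_sum_def min_sum_def l1_dist_def sum_distrib_left sum.distrib[symmetric]
    sum_subtractf[symmetric]
  by (rule sum.cong) auto

lemma l1_dist_nonneg: "0 \<le> l1_dist U V"
  by (simp add: l1_dist_def sum_nonneg)

lemma l1_dist_commute: "l1_dist U V = l1_dist V U"
  by (simp add: l1_dist_def abs_minus_commute)

lemma l1_dist_triangle: "l1_dist U W \<le> l1_dist U V + l1_dist V W"
  unfolding l1_dist_def sum.distrib[symmetric] by (rule sum_mono) auto

lemma l1_dist_eq_0_iff: "l1_dist U V = 0 \<longleftrightarrow> U = V"
  by (simp add: l1_dist_def sum_nonneg_eq_0_iff vec_eq_iff)

text \<open>On nonnegative vectors this is the triangle inequality through the base point 0.\<close>

lemma coord_sum_le: "coord_sum V \<le> coord_sum U + l1_dist U V"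
  unfolding coord_sum_def l1_dist_def sum.distrib[symmetric] by (rule sum_mono) auto

lemma coord_sum_nonneg: "(\<And>j. 0 \<le> U $ j) \<Longrightarrow> 0 \<le> coord_sum U"
  by (simp add: coord_sum_def sum_nonneg)

lemma min_sum_nonneg: "(\<And>j. 0 \<le> U $ j) \<Longrightarrow> (\<And>j. 0 \<le> V $ j) \<Longrightarrow> 0 \<le> min_sum U V"
  by (simp add: min_sum_def sum_nonneg)

lemma J_Tan_commute: "J_Tan U V = J_Tan V U"
  unfolding J_Tan_def by (simp add: max.commute min.commute)

lemma d_Tan_nonneg: "0 \<le> d_Tan U V"
proof -
  have "(\<Sum>j\<in>UNIV. min (U $ j) (V $ j)) \<le> (\<Sum>j\<in>UNIV. max (U $ j) (V $ j))"
    by (rule sum_mono) auto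
  then show ?thesis
    by (simp add: d_Tan_def J_Tan_def)
qed

text \<open>For \<open>U = V = 0\<close> the right-hand side is \<open>0 / 0 = 0\<close>, the correct value.\<close>

lemma d_Tan_eq:
  assumes "\<And>j. 0 \<le> U $ j" "\<And>j. 0 \<le> V $ j"
  shows "d_Tan U V = 2 * l1_dist U V / (coord_sum U + coord_sum V + l1_dist U V)"
proof (cases "coord_sum U + coord_sum V - min_sum U V > 0")
  case True
  then show ?thesis
    by (simp add: d_Tan_def J_Tan_def sum_max_eq min_sum_def[symmetric] l1_dist_eq field_simps)
next
  case False
  then have "U = 0 \<and> V = 0"
    using J_Tan_else_case[of U V] assms sum_max_eq[of U V] by simp
  then show ?thesis
    by (simp add: d_Tan_def J_Tan_def l1_dist_def)
qed

text \<open>Here \<open>a\<close>, \<open>b\<close>, \<open>c\<close> stand for the distances of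
  three points to the base point and \<open>p\<close>, \<open>q\<close>, \<open>r\<close> for those
  between them. As t / (s + t) grows with t for s \<ge> 0, \<open>p\<close> may be raised to
  \<open>q + r\<close>; the common denominator then dominates both \<open>a + b + q\<close> and
  \<open>b + c + r\<close>.\<close>

lemma steinhaus_triangle:
  fixes a b c p q r :: real
  assumes nn: "0 \<le> a" "0 \<le> b" "0 \<le> c" "0 \<le> p" "0 \<le> q" "0 \<le> r"
    and "p \<le> q + r" "b \<le> a + q" "b \<le> c + r"
  shows "p / (a + c + p) \<le> q / (a + b + q) + r / (b + c + r)"
proof (cases "p = 0")
  case True
  then show ?thesis using nn by simp
next
  case False
  then have "0 < p" using nn by simp
  have "p / (a + c + p) \<le> (q + r) / (a + c + (q + r))"
    using nn \<open>0 < p\<close> \<open>p \<le> q + r\<close> mult_right_mono[of p "q + r" "a + c"]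
    by (simp add: divide_simps algebra_simps)
  also have "\<dots> = q / (a + c + (q + r)) + r / (a + c + (q + r))"
    by (rule add_divide_distrib)
  \<comment> \<open>The case \<open>q = 0\<close> is split off because the denominators may vanish
    there.\<close>
  also have "q / (a + c + (q + r)) \<le> q / (a + b + q)"
    using nn \<open>b \<le> c + r\<close> by (cases "q = 0") (auto intro!: divide_left_mono mult_pos_pos)
  also have "r / (a + c + (q + r)) \<le> r / (b + c + r)"
    using nn \<open>b \<le> a + q\<close> by (cases "r = 0") (auto intro!: divide_left_mono mult_pos_pos)
  finally show ?thesis by simp
qed

lemma d_Tan_triangle:
  assumes "\<And>j. 0 \<le> U $ j" "\<And>j. 0 \<le> V $ j" "\<And>j. 0 \<le> W $ j"
  shows "d_Tan U W \<le> d_Tan U V + d_Tan V W"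
proof -
  have "l1_dist U W / (coord_sum U + coord_sum W + l1_dist U W)
      \<le> l1_dist U V / (coord_sum U + coord_sum V + l1_dist U V)
        + l1_dist V W / (coord_sum V + coord_sum W + l1_dist V W)"
    using assms coord_sum_le[of V U] coord_sum_le[of V W] l1_dist_commute[of V W]
    by (intro steinhaus_triangle coord_sum_nonneg l1_dist_nonneg l1_dist_triangle) auto
  then show ?thesis
    using assms by (simp add: d_Tan_eq)
qed

text \<open>The quotient in \<open>d_Tan_eq\<close> is also 0 when its denominator is, but then all
  three nonnegative summands vanish, \<open>l1_dist U V\<close> among them.\<close>

lemma d_Tan_eq_0_iff:
  assumes "\<And>j. 0 \<le> U $ j" "\<And>j. 0 \<le> V $ j"
  shows "d_Tan U V = 0 \<longleftrightarrow> U = V"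
  using assms coord_sum_nonneg[of U] coord_sum_nonneg[of V] l1_dist_nonneg[of U V]
  by (auto simp: d_Tan_eq l1_dist_eq_0_iff add_nonneg_eq_0_iff)

section \<open>Positive semidefiniteness\<close>

text \<open>The equations are imposed only on \<open>A\<close>, so a decomposition may depend on the
  values taken there, as it does for \<open>min\<close>.\<close>

inductive gram :: "'a set \<Rightarrow> ('a \<Rightarrow> 'a \<Rightarrow> real) \<Rightarrow> bool" for A where
  rank1: "(\<And>x y. x \<in> A \<Longrightarrow> y \<in> A \<Longrightarrow> k x y = f x * f y) \<Longrightarrow> gram A k"
| add: "gram A k1 \<Longrightarrow> gram A k2 \<Longrightarrow>
    (\<And>x y. x \<in> A \<Longrightarrow> y \<in> A \<Longrightarrow> k x y = k1 x y + k2 x y) \<Longrightarrow> gram A k"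

lemma gram_cong:
  assumes "gram A k" "\<And>x y. x \<in> A \<Longrightarrow> y \<in> A \<Longrightarrow> l x y = k x y"
  shows "gram A l"
  using assms(1)
proof cases
  case (rank1 f)
  then show ?thesis by (intro gram.rank1[of A l f]) (simp add: assms(2))
next
  case (add k1 k2)
  show ?thesis by (rule gram.add[OF add(1,2)]) (simp add: add(3) assms(2))
qed

lemma gram_mult_rank1:
  assumes "gram A k"
  shows "gram A (\<lambda>x y. f x * f y * k x y)"
  using assms
proof induction
  case (rank1 k g)
  show ?case by (rule gram.rank1[of _ _ "\<lambda>x. f x * g x"]) (simp add: rank1 mult_ac)
next
  case (add k1 k2 k)
  show ?case by (rule gram.add[OF add.IH]) (simp add: add.hyps algebra_simps)
qed

text \<open>Distributing over both decompositions leaves products of rank-one kernels, which are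
  again rank one.\<close>

lemma gram_mult:
  assumes "gram A k" "gram A l"
  shows "gram A (\<lambda>x y. k x y * l x y)"
  using assms(1)
proof induction
  case (rank1 k f)
  show ?case by (rule gram_cong[OF gram_mult_rank1[OF assms(2), of f]]) (simp add: rank1)
next
  case (add k1 k2 k)
  show ?case by (rule gram.add[OF add.IH]) (simp add: add.hyps algebra_simps)
qed

lemma gram_power: "gram A k \<Longrightarrow> gram A (\<lambda>x y. k x y ^ n)"
proof (induction n)
  case 0
  show ?case by (rule gram.rank1[of _ _ "\<lambda>_. 1"]) simp
next
  case (Suc n)
  then show ?case using gram_mult[OF Suc.prems Suc.IH] by simp
qed

lemma gram_sum:
  assumes "finite I" "\<And>i. i \<in> I \<Longrightarrow> gram A (k i)"
  shows "gram A (\<lambda>x y. \<Sum>i\<in>I. k i x y)"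
  using assms
proof (induction I)
  case empty
  show ?case by (rule gram.rank1[of _ _ "\<lambda>_. 0"]) simp
next
  case (insert i I)
  then have "gram A (k i)" "gram A (\<lambda>x y. \<Sum>i\<in>I. k i x y)" by auto
  then show ?case by (rule gram.add) (simp add: insert.hyps)
qed

text \<open>Each rank-one summand contributes the square of
  \<open>\<Sum>i<m. c i * f (x i)\<close>.\<close>

lemma gram_quadratic_form_nonneg:
  fixes m :: nat
  assumes "gram A k" "\<And>i. i < m \<Longrightarrow> x i \<in> A"
  shows "0 \<le> (\<Sum>i<m. \<Sum>j<m. c i * c j * k (x i) (x j))"
  using assms(1)
proof induction
  case (rank1 k f)
  have "(\<Sum>i<m. \<Sum>j<m. c i * c j * k (x i) (x j)) =
    (\<Sum>i<m. \<Sum>j<m. (c i * f (x i)) * (c j * f (x j)))"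
    using assms(2) by (intro sum.cong) (auto simp: rank1)
  also have "\<dots> = (\<Sum>i<m. c i * f (x i)) * (\<Sum>i<m. c i * f (x i))"
    by (rule sum_product[symmetric])
  finally show ?case by simp
next
  case (add k1 k2 k)
  have "(\<Sum>i<m. \<Sum>j<m. c i * c j * k (x i) (x j)) =
    (\<Sum>i<m. \<Sum>j<m. c i * c j * k1 (x i) (x j) + c i * c j * k2 (x i) (x j))"
    using assms(2) by (intro sum.cong) (auto simp: add.hyps algebra_simps)
  then show ?case using add.IH by (simp add: sum.distrib)
qed

text \<open>The weight of \<open>v\<close> is the gap between \<open>v\<close> and the next smaller element of \<open>S \<union> {0}\<close>.\<close>

lemma gap_weights:
  fixes S :: "real set"
  assumes "finite S" "\<And>s. s \<in> S \<Longrightarrow> 0 \<le> s"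
  shows "\<exists>w. (\<forall>v. 0 \<le> w v) \<and> (\<forall>s\<in>S. (\<Sum>v\<in>{v\<in>S. v \<le> s}. w v) = s)"
  using assms
proof (induction S rule: finite_linorder_max_induct)
  case empty
  show ?case by (intro exI[of _ "\<lambda>_. 0"]) simp
next
  case (insert b S)
  then obtain w where w: "\<And>v. 0 \<le> w v" "\<And>s. s \<in> S \<Longrightarrow> (\<Sum>v\<in>{v\<in>S. v \<le> s}. w v) = s"
    using insert.IH insert.prems by (metis insertCI)
  \<comment> \<open>The gaps telescope to the largest element of \<open>S\<close>, or to 0 if
    \<open>S\<close> is empty; hence the weight \<open>b - sum w S\<close> given to \<open>b\<close>
    is nonnegative.\<close>
  have le: "sum w S \<le> b"
  proof (cases "S = {}")
    case True
    then show ?thesis using insert by simp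
  next
    case False
    then have M: "Max S \<in> S" using insert by simp
    have "{v\<in>S. v \<le> Max S} = S" using insert by auto
    then have "sum w S = Max S" using w(2)[OF M] by simp
    then show ?thesis using M insert by force
  qed
  have nb: "b \<notin> S" using insert by auto
  define w' where "w' = w(b := b - sum w S)"
  have w': "sum w' T = sum w T" if "b \<notin> T" for T
    using that by (intro sum.cong) (auto simp: w'_def)
  have "(\<Sum>v\<in>{v\<in>insert b S. v \<le> s}. w' v) = s" if "s \<in> insert b S" for s
  proof (cases "s = b")
    case True
    have "{v\<in>insert b S. v \<le> s} = insert b S" using True insert by auto
    then show ?thesis using True insert nb by (simp add: w') (simp add: w'_def)
  next
    case False
    then have s: "s \<in> S" using that by simp
    then have "s < b" using insert by auto
    then have "{v\<in>insert b S. v \<le> s} = {v\<in>S. v \<le> s}" by auto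
    then show ?thesis using w(2)[OF s] nb by (simp add: w')
  qed
  moreover have "0 \<le> w' v" for v using w(1) le by (simp add: w'_def)
  ultimately show ?case by blast
qed

text \<open>A threshold \<open>v\<close> is at most \<open>min (f x) (f y)\<close> iff it is at most
  both values, so cutting the minimum into gap weights yields products of indicators;
  \<open>sqrt (w v)\<close> shares each weight between the two arguments.\<close>

lemma gram_min:
  fixes f :: "'a \<Rightarrow> real"
  assumes "finite A" "\<And>x. x \<in> A \<Longrightarrow> 0 \<le> f x"
  shows "gram A (\<lambda>x y. min (f x) (f y))"
proof -
  have "finite (f ` A)" "\<And>s. s \<in> f ` A \<Longrightarrow> 0 \<le> s" using assms by auto
  from gap_weights[OF this]
  obtain w where w: "\<And>v. 0 \<le> w v" "\<And>s. s \<in> f ` A \<Longrightarrow> (\<Sum>v\<in>{v\<in>f ` A. v \<le> s}. w v) = s" by blast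
  have "gram A (\<lambda>x y. \<Sum>v\<in>f ` A. (sqrt (w v) * of_bool (v \<le> f x)) * (sqrt (w v) * of_bool (v \<le> f y)))"
    using assms(1) by (intro gram_sum) (auto intro: gram.rank1[OF refl])
  then show ?thesis
  proof (rule gram_cong)
    fix x y assume xy: "x \<in> A" "y \<in> A"
    then have "min (f x) (f y) \<in> f ` A" by (simp add: min_def)
    from w(2)[OF this, symmetric] have "min (f x) (f y) = (\<Sum>v\<in>{v\<in>f ` A. v \<le> min (f x) (f y)}. w v)" .
    also have "\<dots> = (\<Sum>v\<in>f ` A. if v \<le> min (f x) (f y) then w v else 0)"
      using assms(1) by (simp add: sum.inter_filter)
    also have "\<dots> = (\<Sum>v\<in>f ` A. (sqrt (w v) * of_bool (v \<le> f x)) * (sqrt (w v) * of_bool (v \<le> f y)))"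
      using w(1) by (intro sum.cong) auto
    finally show "min (f x) (f y) = \<dots>" .
  qed
qed

section \<open>Geometric series for the Tanimoto kernel\<close>

definition tan_num :: "real ^ 'd \<Rightarrow> real ^ 'd \<Rightarrow> real" where
  "tan_num U V = 2 * min_sum U V / ((coord_sum U + 1) * (coord_sum V + 1))"

text \<open>The common ratio \<open>L\<close> of the series, whose first term \<open>h\<close> is
  \<open>tan_num\<close>.\<close>

definition tan_ratio :: "real ^ 'd \<Rightarrow> real ^ 'd \<Rightarrow> real" where
  "tan_ratio U V =
     ((coord_sum U - 1) / (coord_sum U + 1)) * ((coord_sum V - 1) / (coord_sum V + 1)) + tan_num U V"

lemma gram_tan_num:
  assumes "finite A" "\<And>U j. U \<in> A \<Longrightarrow> 0 \<le> U $ j"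
  shows "gram A tan_num"
proof -
  have "gram A min_sum"
    unfolding min_sum_def[abs_def] using assms by (intro gram_sum gram_min) auto
  from gram_mult_rank1[OF this, of "\<lambda>U. sqrt 2 / (coord_sum U + 1)"] show ?thesis
    by (rule gram_cong) (simp add: tan_num_def)
qed

lemma gram_tan_ratio:
  assumes "finite A" "\<And>U j. U \<in> A \<Longrightarrow> 0 \<le> U $ j"
  shows "gram A tan_ratio"
  by (rule gram.add[OF gram.rank1[OF refl, of _ "\<lambda>U. (coord_sum U - 1) / (coord_sum U + 1)"]
        gram_tan_num[OF assms]]) (simp_all add: tan_ratio_def)

text \<open>At \<open>U = V = 0\<close> the ratio is 1, but all terms of the series vanish.\<close>

lemma J_Tan_sums:
  assumes nn: "\<And>j. 0 \<le> U $ j" "\<And>j. 0 \<le> V $ j"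
  shows "(\<lambda>n. tan_num U V * tan_ratio U V ^ n) sums (J_Tan U V - of_bool (U = 0) * of_bool (V = 0))"
proof (cases "coord_sum U + coord_sum V - min_sum U V > 0")
  case True
  define a b m where "a = coord_sum U" and "b = coord_sum V" and "m = min_sum U V"
  have ge: "0 \<le> a" "0 \<le> b" "0 \<le> m" and pos: "0 < a + b - m"
    using nn True by (auto simp: a_def b_def m_def coord_sum_nonneg min_sum_nonneg)
  have nz: "a + 1 \<noteq> 0" "b + 1 \<noteq> 0" using ge by auto
  have h: "tan_num U V = 2 * m / ((a + 1) * (b + 1))"
    by (simp add: tan_num_def a_def b_def m_def)
  have "1 - ((a - 1) / (a + 1)) * ((b - 1) / (b + 1)) = 2 * (a + b) / ((a + 1) * (b + 1))"
    using nz by (simp add: divide_simps) (simp add: algebra_simps)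
  then have lt: "1 - tan_ratio U V = 2 * (a + b - m) / ((a + 1) * (b + 1))"
    by (simp add: tan_ratio_def h a_def[symmetric] b_def[symmetric] diff_divide_distrib
        algebra_simps)
  have "1 + ((a - 1) / (a + 1)) * ((b - 1) / (b + 1)) = 2 * (a * b + 1) / ((a + 1) * (b + 1))"
    using nz by (simp add: divide_simps) (simp add: algebra_simps)
  then have gt: "1 + tan_ratio U V = 2 * (a * b + 1 + m) / ((a + 1) * (b + 1))"
    by (simp add: tan_ratio_def h a_def[symmetric] b_def[symmetric] add_divide_distrib
        algebra_simps)
  \<comment> \<open>Both closed forms have positive numerators and denominators, which puts the
    ratio strictly between -1 and 1.\<close>
  have "0 < 1 - tan_ratio U V" "0 < 1 + tan_ratio U V"
    unfolding lt gt using ge pos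
    by (intro divide_pos_pos mult_pos_pos add_nonneg_pos add_pos_nonneg mult_nonneg_nonneg; simp)+
  then have "\<bar>tan_ratio U V\<bar> < 1" by linarith
  then have "(\<lambda>n. tan_num U V * tan_ratio U V ^ n) sums (tan_num U V * (1 / (1 - tan_ratio U V)))"
    by (intro sums_mult geometric_sums) simp
  moreover have "tan_num U V * (1 / (1 - tan_ratio U V)) = m / (a + b - m)"
    unfolding lt h using nz mult_divide_mult_cancel_left[of 2 m "a + b - m"] by simp
  moreover have "J_Tan U V = m / (a + b - m)"
    using True by (simp add: J_Tan_def sum_max_eq min_sum_def a_def b_def m_def)
  moreover have "\<not> (U = 0 \<and> V = 0)"
    using True by (auto simp: coord_sum_def min_sum_def)
  ultimately show ?thesis by auto
next
  case False
  then have "U = 0 \<and> V = 0"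
    using J_Tan_else_case[of U V] nn sum_max_eq[of U V] by simp
  then show ?thesis
    by (simp add: J_Tan_def tan_num_def min_sum_def)
qed

lemma J_Tan_psd: "psd_kernel_on {U. \<forall>j. 0 \<le> U $ j} J_Tan"
  unfolding psd_kernel_on_def
proof (intro conjI ballI allI impI)
  fix m :: nat and x :: "nat \<Rightarrow> real ^ 'd" and c :: "nat \<Rightarrow> real"
  assume "\<forall>i<m. x i \<in> {U. \<forall>j. 0 \<le> U $ j}"
  then have nn: "\<And>i j. i < m \<Longrightarrow> 0 \<le> x i $ j" by auto
  \<comment> \<open>\<open>gram_min\<close> works on finite sets, so the decompositions are made on
    the sample points.\<close>
  define A where "A = x ` {..<m}"
  \<comment> \<open>The series gives 0 at the pair (0, 0), where \<open>J_Tan\<close> is 1; the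
    rank-one kernel \<open>e U * e V\<close> restores this value.\<close>
  define e :: "real ^ 'd \<Rightarrow> real" where "e U = of_bool (U = 0)" for U
  have A: "finite A" "\<And>U j. U \<in> A \<Longrightarrow> 0 \<le> U $ j" and xA: "\<And>i. i < m \<Longrightarrow> x i \<in> A"
    using nn by (auto simp: A_def)
  let ?q = "\<lambda>k. \<Sum>i<m. \<Sum>j<m. c i * c j * k (x i) (x j)"
  let ?s = "\<lambda>N U V. \<Sum>n<N. tan_num U V * tan_ratio U V ^ n"
  have "(\<lambda>N. ?s N (x i) (x j)) \<longlonglongrightarrow> J_Tan (x i) (x j) - e (x i) * e (x j)" if "i < m" "j < m" for i j
    using J_Tan_sums[of "x i" "x j"] nn that by (simp add: sums_def e_def)
  then have "(\<lambda>N. ?q (?s N)) \<longlonglongrightarrow> ?q (\<lambda>U V. J_Tan U V - e U * e V)"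
    by (intro tendsto_sum tendsto_mult tendsto_const) auto
  moreover have "0 \<le> ?q (?s N)" for N
    using A xA by (intro gram_quadratic_form_nonneg gram_sum gram_mult gram_power gram_tan_num
        gram_tan_ratio) auto
  ultimately have "0 \<le> ?q (\<lambda>U V. J_Tan U V - e U * e V)"
    by (intro LIMSEQ_le_const) auto
  moreover have "0 \<le> ?q (\<lambda>U V. e U * e V)"
    using xA by (intro gram_quadratic_form_nonneg[of A] gram.rank1[OF refl])
  ultimately show "0 \<le> ?q J_Tan"
    by (simp add: right_diff_distrib sum_subtractf)
qed (rule J_Tan_commute)

section \<open>Nonnegative embeddings\<close>

lemma nonneg_embedding:
  fixes \<psi> :: "'a \<Rightarrow> real ^ 'd"
  assumes "\<And>Z j. 0 \<le> \<psi> Z $ j"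
  shows "Metric_space (range \<psi>) d_Tan" "pseudometric_on UNIV (d_emb \<psi>)"
    "psd_kernel_on UNIV (K_emb \<psi>)"
proof -
  show M: "Metric_space (range \<psi>) d_Tan"
  proof
    fix U V W :: "real ^ 'd"
    show "0 \<le> d_Tan U V" by (rule d_Tan_nonneg)
    show "d_Tan U V = d_Tan V U" by (simp add: d_Tan_def J_Tan_commute[of U V])
    assume U: "U \<in> range \<psi>" and V: "V \<in> range \<psi>"
    then show "d_Tan U V = 0 \<longleftrightarrow> U = V" using assms by (auto intro!: d_Tan_eq_0_iff)
    assume "W \<in> range \<psi>"
    with U V show "d_Tan U W \<le> d_Tan U V + d_Tan V W"
      using assms by (auto intro!: d_Tan_triangle)
  qed
  \<comment> \<open>Separation does not carry over from the range, since \<psi> may identify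
    points.\<close>
  show "pseudometric_on UNIV (d_emb \<psi>)"
    using M by (auto simp: Metric_space_def pseudometric_on_def d_emb_def)
  show "psd_kernel_on UNIV (K_emb \<psi>)"
    unfolding psd_kernel_on_def K_emb_def
  proof (intro conjI ballI allI impI)
    fix m :: nat and x :: "nat \<Rightarrow> 'a" and c :: "nat \<Rightarrow> real"
    have "\<forall>i<m. \<psi> (x i) \<in> {U. \<forall>j. 0 \<le> U $ j}" using assms by simp
    then show "0 \<le> (\<Sum>i<m. \<Sum>j<m. c i * c j * J_Tan (\<psi> (x i)) (\<psi> (x j)))"
      using conjunct2[OF J_Tan_psd[unfolded psd_kernel_on_def], rule_format,
          of m "\<lambda>i. \<psi> (x i)" c] by blast
  qed (rule J_Tan_commute)
qed

theorem theorem3p27: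
  fixes \<Theta> :: "'k::finite \<Rightarrow> real set"
  assumes "phase_partition \<Theta>"
  shows "Metric_space (range (psi_C :: complex ^ 'n::finite \<Rightarrow> real ^ ('n \<times> 4))) d_Tan \<and>
         pseudometric_on UNIV (d_emb (psi_C :: complex ^ 'n::finite \<Rightarrow> real ^ ('n \<times> 4))) \<and>
         psd_kernel_on UNIV (K_emb (psi_C :: complex ^ 'n::finite \<Rightarrow> real ^ ('n \<times> 4))) \<and>
         Metric_space (range (psi_P \<Theta> :: complex ^ 'n::finite \<Rightarrow> real ^ ('n \<times> 'k))) d_Tan \<and>
         pseudometric_on UNIV (d_emb (psi_P \<Theta> :: complex ^ 'n::finite \<Rightarrow> real ^ ('n \<times> 'k))) \<and>
         psd_kernel_on UNIV (K_emb (psi_P \<Theta> :: complex ^ 'n::finite \<Rightarrow> real ^ ('n \<times> 'k)))"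
  by (intro conjI nonneg_embedding psi_C_nonneg psi_P_nonneg)

end
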